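(* A Hilbert $C^*$-module $\mathscr{H}$ of $\mathscr{E}$-valued functions on a set $S$ is a relative reproducing kernel Hilbert $C^*$-module if and only if there are a map $h:\mathscr{E}\times S\to\mathscr{H}$, $(x,s)\mapsto h_{x,s}$, and a possibly unbounded $\mathfrak{A}$-linear map $\varphi:\mathscr{E}\times\mathscr{H}\to\mathfrak{A}$ such that $$\langle f(s),x\rangle=\langle f,h_{x,s}\rangle+\varphi(x,f),\qquad f\in\mathscr{H},\ x\in\mathscr{E},\ s\in S.$$
   Context: $S$ is a nonempty set, $\mathfrak{A}$ is a $C^*$-algebra, and $\mathscr{E}$ and $\mathscr{H}$ are Hilbert $C^*$-modules over $\mathfrak{A}$ (right modules; inner product linear in the second variable, $\langle x,ya\rangle=\langle x,y\rangle a$, $\langle y,x\rangle=\langle x,y\rangle^*$). An $\mathfrak{A}$-linear map $f$ between Hilbert $\mathfrak{A}$-modules is a linear map satisfying $f(xa)=f(x)a$ for all $a\in\mathfrak{A}$ and all $x$ in its domain; $\mathfrak{A}$ is a Hilbert module over itself with $\langle a,b\rangle=a^*b$. Modules of $\mathscr{E}$-valued functions on $S$ carry the pointwise linear operations and the action $(f\cdot a)(s)=f(s)a$. A Hilbert $\mathfrak{A}$-module $\mathscr{H}$ of $\mathscr{E}$-valued functions on $S$ is a relative reproducing kernel Hilbert $C^*$-module if there is a map $D:\mathscr{E}\times S\times S\to\mathscr{H}$, $(x,s,t)\mapsto D_{x,s,t}$, such that $\langle f(s)-f(t),x\rangle=\langle f,D_{x,s,t}\rangle$ for all $f\in\mathscr{H}$,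 $x\in\mathscr{E}$, $s,t\in S$.
   Formalization: The map φ is taken to be 𝔄-linear in x and conjugate 𝔄-linear in f (φ(x,fa)=a*φ(x,f)); literal 𝔄-linearity in f or jointly on E×H would force φ=0 and make the forward implication false. *)

theory Defs
  imports Complex_Main "HOL-Library.Function_Algebras"
begin

class complex_vector = ab_group_add +
  fixes scaleC :: "complex \<Rightarrow> 'a \<Rightarrow> 'a"  (infixr "*\<^sub>C" 75)
  assumes scaleC_add_right: "c *\<^sub>C (x + y) = c *\<^sub>C x + c *\<^sub>C y"
    and scaleC_add_left: "(c + d) *\<^sub>C x = c *\<^sub>C x + d *\<^sub>C x"
    and scaleC_scaleC: "c *\<^sub>C (d *\<^sub>C x) = (c * d) *\<^sub>C x"
    and scaleC_one: "1 *\<^sub>C x = x"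

global_interpretation complex_vector: vector_space "scaleC :: complex \<Rightarrow> 'a::complex_vector \<Rightarrow> 'a"
  by standard (rule scaleC_add_right scaleC_add_left scaleC_scaleC scaleC_one)+

instantiation "fun" :: (type, complex_vector) complex_vector
begin

definition scaleC_fun :: "complex \<Rightarrow> ('a \<Rightarrow> 'b) \<Rightarrow> 'a \<Rightarrow> 'b"
  where "c *\<^sub>C f = (\<lambda>s. c *\<^sub>C f s)"

instance
  by standard
    (simp_all add: scaleC_fun_def fun_eq_iff scaleC_add_right scaleC_add_left scaleC_scaleC scaleC_one)

end

text \<open>
  No unit is assumed. The real structure comes from the library classes and is tied to the complex
  one by \<open>scaleR_scaleC\<close>.
\<close>

class cstar_algebra = complex_vector + real_normed_algebra + banach +
  fixes star :: "'a \<Rightarrow> 'a"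
  assumes scaleR_scaleC: "r *\<^sub>R a = complex_of_real r *\<^sub>C a"
    and mult_scaleC_left: "(c *\<^sub>C a) * b = c *\<^sub>C (a * b)"
    and mult_scaleC_right: "a * (c *\<^sub>C b) = c *\<^sub>C (a * b)"
    and norm_scaleC: "norm (c *\<^sub>C a) = cmod c * norm a"
    and star_star: "star (star a) = a"
    and star_add: "star (a + b) = star a + star b"
    and star_scaleC: "star (c *\<^sub>C a) = cnj c *\<^sub>C star a"
    and star_mult: "star (a * b) = star b * star a"
    and cstar_identity: "norm (star a * a) = (norm a)\<^sup>2"

definition cstar_positive :: "'a::cstar_algebra \<Rightarrow> bool"
  where "cstar_positive a \<longleftrightarrow> (\<exists>b. a = star b * b)"

text \<open>
  A right Hilbert module over \<open>'a\<close> carried by a linear subspace \<open>M\<close> of the ambient type;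
  \<open>act x a\<close> is the product \<open>x a\<close> and \<open>ip\<close> is linear in its second variable. Nothing is required
  of \<open>ip\<close> outside \<open>M\<close>.
\<close>

locale hilbert_cstar_module =
  fixes M :: "'m::complex_vector set"
    and act :: "'m \<Rightarrow> 'a::cstar_algebra \<Rightarrow> 'm"
    and ip :: "'m \<Rightarrow> 'm \<Rightarrow> 'a"
  assumes subspace: "complex_vector.subspace M"
    and act_closed: "x \<in> M \<Longrightarrow> act x a \<in> M"
    and act_add_left: "x \<in> M \<Longrightarrow> y \<in> M \<Longrightarrow> act (x + y) a = act x a + act y a"
    and act_add_right: "x \<in> M \<Longrightarrow> act x (a + b) = act x a + act x b"
    and act_mult: "x \<in> M \<Longrightarrow> act x (a * b) = act (act x a) b"
    and act_scaleC_left: "x \<in> M \<Longrightarrow> act (c *\<^sub>C x) a = c *\<^sub>C act x a"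
    and act_scaleC_right: "x \<in> M \<Longrightarrow> act x (c *\<^sub>C a) = c *\<^sub>C act x a"
    and ip_add_right: "x \<in> M \<Longrightarrow> y \<in> M \<Longrightarrow> z \<in> M \<Longrightarrow> ip x (y + z) = ip x y + ip x z"
    and ip_scaleC_right: "x \<in> M \<Longrightarrow> y \<in> M \<Longrightarrow> ip x (c *\<^sub>C y) = c *\<^sub>C ip x y"
    and ip_act_right: "x \<in> M \<Longrightarrow> y \<in> M \<Longrightarrow> ip x (act y a) = ip x y * a"
    and ip_star: "x \<in> M \<Longrightarrow> y \<in> M \<Longrightarrow> ip y x = star (ip x y)"
    and ip_positive: "x \<in> M \<Longrightarrow> cstar_positive (ip x x)"
    and ip_definite: "x \<in> M \<Longrightarrow> ip x x = 0 \<Longrightarrow> x = 0"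
    and complete:
      "\<lbrakk>\<And>n. X n \<in> M;
        \<And>e. e > 0 \<Longrightarrow> \<exists>N. \<forall>m\<ge>N. \<forall>n\<ge>N. sqrt (norm (ip (X m - X n) (X m - X n))) < e\<rbrakk>
       \<Longrightarrow> \<exists>L\<in>M. (\<lambda>n. sqrt (norm (ip (X n - L) (X n - L)))) \<longlonglongrightarrow> 0"

definition pointwise_act :: "('e \<Rightarrow> 'a \<Rightarrow> 'e) \<Rightarrow> ('s \<Rightarrow> 'e) \<Rightarrow> 'a \<Rightarrow> 's \<Rightarrow> 'e"
  where "pointwise_act act f a = (\<lambda>s. act (f s) a)"

text \<open>
  The module of values is the whole type \<open>'e\<close> and the nonempty set \<open>S\<close> is the type \<open>'s\<close>.
  Addition and complex scalar multiplication on \<open>H\<close> are those of the function type, hence pointwise.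
\<close>

locale hilbert_cstar_module_of_functions =
  E: hilbert_cstar_module UNIV actE ipE + H: hilbert_cstar_module H "pointwise_act actE" ipH
  for actE :: "'e::complex_vector \<Rightarrow> 'a::cstar_algebra \<Rightarrow> 'e"
    and ipE :: "'e \<Rightarrow> 'e \<Rightarrow> 'a"
    and H :: "('s \<Rightarrow> 'e) set"
    and ipH :: "('s \<Rightarrow> 'e) \<Rightarrow> ('s \<Rightarrow> 'e) \<Rightarrow> 'a"

definition relative_rkhm ::
  "('e::complex_vector \<Rightarrow> 'e \<Rightarrow> 'a::cstar_algebra) \<Rightarrow> ('s \<Rightarrow> 'e) set
    \<Rightarrow> (('s \<Rightarrow> 'e) \<Rightarrow> ('s \<Rightarrow> 'e) \<Rightarrow> 'a) \<Rightarrow> bool"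
  where "relative_rkhm ipE H ipH \<longleftrightarrow>
    (\<exists>D :: 'e \<Rightarrow> 's \<Rightarrow> 's \<Rightarrow> 's \<Rightarrow> 'e.
      (\<forall>x s t. D x s t \<in> H) \<and>
      (\<forall>f\<in>H. \<forall>x s t. ipE (f s - f t) x = ipH f (D x s t)))"

definition A_linear_on ::
  "'m::complex_vector set \<Rightarrow> ('m \<Rightarrow> 'a::cstar_algebra \<Rightarrow> 'm) \<Rightarrow> ('n::complex_vector \<Rightarrow> 'a \<Rightarrow> 'n)
    \<Rightarrow> ('m \<Rightarrow> 'n) \<Rightarrow> bool"
  where "A_linear_on M act act' T \<longleftrightarrow>
    (\<forall>x\<in>M. \<forall>y\<in>M. T (x + y) = T x + T y) \<and>
    (\<forall>c. \<forall>x\<in>M. T (c *\<^sub>C x) = c *\<^sub>C T x) \<and>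
    (\<forall>a. \<forall>x\<in>M. T (act x a) = act' (T x) a)"

text \<open>
  \<open>\<A>\<close>-linearity of \<open>\<phi> : E \<times> H \<rightarrow> \<A>\<close>, without any boundedness: \<open>\<A>\<close>-linear in the first variable
  and conjugate \<open>\<A>\<close>-linear in the second, i.e. \<open>\<phi> x (f a) = a\<^sup>* (\<phi> x f)\<close>, which is
  \<open>\<A>\<close>-linearity of \<open>f \<mapsto> (\<phi> x f)\<^sup>*\<close>. This is the variance of \<open>\<langle>f s, x\<rangle>\<close> and \<open>\<langle>f, h x s\<rangle>\<close>.
  Joint linearity on \<open>E \<oplus> H\<close> is not meant: together with the representation formula it would
  force \<open>\<phi> = 0\<close> on \<open>H\<close>. The algebra is a right module over itself by multiplication.
\<close>

definition A_linear_form_on ::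
  "('e::complex_vector \<Rightarrow> 'a::cstar_algebra \<Rightarrow> 'e) \<Rightarrow> ('s \<Rightarrow> 'e) set
    \<Rightarrow> ('e \<Rightarrow> ('s \<Rightarrow> 'e) \<Rightarrow> 'a) \<Rightarrow> bool"
  where "A_linear_form_on actE H \<phi> \<longleftrightarrow>
    (\<forall>f\<in>H. A_linear_on UNIV actE (*) (\<lambda>x. \<phi> x f)) \<and>
    (\<forall>x. A_linear_on H (pointwise_act actE) (*) (\<lambda>f. star (\<phi> x f)))"

end

theory Submission
  imports Defs
begin

text \<open>
  A relative kernel controls only differences \<open>f s - f t\<close>; fixing a base point \<open>t\<^sub>0\<close> turns this into
  control of \<open>f s\<close> up to the term \<open>\<langle>f t\<^sub>0, x\<rangle>\<close>, which does not depend on \<open>s\<close>. That term is the form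
  \<open>\<phi> x f\<close>, and \<open>h x s = D x s t\<^sub>0\<close>. Evaluation at \<open>t\<^sub>0\<close> is \<open>\<A>\<close>-linear but in general unbounded
  for the norm of \<open>H\<close>, which is why \<open>\<phi>\<close> may be unbounded. Conversely, \<open>\<phi>\<close> is the
  same for all points of \<open>S\<close>, so it cancels in the representation of \<open>\<langle>f s, x\<rangle> - \<langle>f t, x\<rangle>\<close>, and
  \<open>D x s t = h x s - h x t\<close> is a relative kernel.
\<close>

context hilbert_cstar_module
begin

lemma ip_diff_right:
  assumes "x \<in> M" "y \<in> M" "z \<in> M"
  shows "ip x (y - z) = ip x y - ip x z"
proof -
  have "ip x ((y - z) + z) = ip x (y - z) + ip x z"
    using assms by (intro ip_add_right complex_vector.subspace_diff[OF subspace])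
  then show ?thesis
    by simp
qed

lemma ip_diff_left:
  assumes "x \<in> M" "y \<in> M" "z \<in> M"
  shows "ip (x - y) z = ip x z - ip y z"
proof -
  have xy: "x - y \<in> M"
    using assms by (intro complex_vector.subspace_diff[OF subspace])
  have "ip (x - y) z + ip y z = star (ip z (x - y) + ip z y)"
    using assms xy by (simp add: star_add ip_star[of z])
  also have "\<dots> = ip x z"
    using assms by (simp add: ip_diff_right ip_star[of z x])
  finally show ?thesis
    by (simp add: algebra_simps)
qed

end

text \<open>
  Conjugate \<open>\<A>\<close>-linearity in \<open>f\<close> comes down to \<open>\<langle>f t, x\<rangle>\<^sup>* = \<langle>x, f t\<rangle>\<close>: the inner product is
  \<open>\<A>\<close>-linear in its second variable and the module operations of \<open>H\<close> are pointwise.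
\<close>

lemma (in hilbert_cstar_module_of_functions) A_linear_form_evaluation:
  "A_linear_form_on actE H (\<lambda>x f. ipE (f t) x)"
proof -
  have star_ip: "star (ipE y x) = ipE x y" for x y
    by (rule E.ip_star[symmetric]) simp_all
  show ?thesis
    by (simp add: A_linear_form_on_def A_linear_on_def star_ip pointwise_act_def scaleC_fun_def
        E.ip_add_right E.ip_scaleC_right E.ip_act_right)
qed

theorem proposition4p3:
  fixes actE :: "'e::complex_vector \<Rightarrow> 'a::cstar_algebra \<Rightarrow> 'e"
    and ipE :: "'e \<Rightarrow> 'e \<Rightarrow> 'a"
    and H :: "('s \<Rightarrow> 'e) set"
    and ipH :: "('s \<Rightarrow> 'e) \<Rightarrow> ('s \<Rightarrow> 'e) \<Rightarrow> 'a"
  assumes "hilbert_cstar_module_of_functions actE ipE H ipH"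
  shows "relative_rkhm ipE H ipH \<longleftrightarrow>
    (\<exists>(h :: 'e \<Rightarrow> 's \<Rightarrow> 's \<Rightarrow> 'e) (\<phi> :: 'e \<Rightarrow> ('s \<Rightarrow> 'e) \<Rightarrow> 'a).
      (\<forall>x s. h x s \<in> H) \<and>
      A_linear_form_on actE H \<phi> \<and>
      (\<forall>f\<in>H. \<forall>x s. ipE (f s) x = ipH f (h x s) + \<phi> x f))"
    (is "_ \<longleftrightarrow> ?represented")
proof -
  interpret hilbert_cstar_module_of_functions actE ipE H ipH
    by (rule assms)
  show ?thesis
  proof
    assume "relative_rkhm ipE H ipH"
    then obtain D :: "'e \<Rightarrow> 's \<Rightarrow> 's \<Rightarrow> 's \<Rightarrow> 'e"
      where D_in: "\<And>x s t. D x s t \<in> H"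
        and D: "\<And>f x s t. f \<in> H \<Longrightarrow> ipE (f s - f t) x = ipH f (D x s t)"
      unfolding relative_rkhm_def by blast
    \<comment> \<open>Any point serves as base point; a type is never empty.\<close>
    define t\<^sub>0 :: 's where "t\<^sub>0 = undefined"
    have "ipE (f s) x = ipH f (D x s t\<^sub>0) + ipE (f t\<^sub>0) x" if "f \<in> H" for f x s
      by (simp add: D[OF that, symmetric] E.ip_diff_left)
    with D_in A_linear_form_evaluation[of t\<^sub>0] show ?represented
      by (intro exI[of _ "\<lambda>x s. D x s t\<^sub>0"] exI[of _ "\<lambda>x f. ipE (f t\<^sub>0) x"]) blast
  next
    assume ?represented
    then obtain h :: "'e \<Rightarrow> 's \<Rightarrow> 's \<Rightarrow> 'e" and \<phi> :: "'e \<Rightarrow> ('s \<Rightarrow> 'e) \<Rightarrow> 'a"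
      where h_in: "\<And>x s. h x s \<in> H"
        and h: "\<And>f x s. f \<in> H \<Longrightarrow> ipE (f s) x = ipH f (h x s) + \<phi> x f"
      by blast
    have "h x s - h x t \<in> H" for x s t
      by (intro complex_vector.subspace_diff[OF H.subspace] h_in)
    moreover have "ipE (f s - f t) x = ipH f (h x s - h x t)" if "f \<in> H" for f x s t
      using that by (simp add: E.ip_diff_left H.ip_diff_right h_in h)
    ultimately show "relative_rkhm ipE H ipH"
      unfolding relative_rkhm_def by (intro exI[of _ "\<lambda>x s t. h x s - h x t"]) blast
  qed
qed

end
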